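(* Let $M$ be a uniform matroid on a finite ground set $E$. For every total order $\preceq$ on $E$, the width of each of the BDDs $\mathsf{B}(\mathcal{I}(M))$, $\mathsf{B}(\mathcal{B}(M))$ and ZDDs $\mathsf{Z}(\mathcal{I}(M))$, $\mathsf{Z}(\mathcal{B}(M))$ with respect to $(E,\preceq)$ is at most $\mathrm{pw}(M)+1$.
   Context: $M$ is uniform if its independent sets are the subsets of size at most $r(M)$. $\mathcal{I}(M)$, $\mathcal{B}(M)$ are the collections of independent sets and bases. $r_M$ is the rank function, $\lambda_M(X)=r_M(X)+r_M(E\setminus X)-r_M(E)$, and $\mathrm{pw}(M)=\min_{\preceq}\max_{i\in\{1,\ldots,n\}}\lambda_M(\{e_1,\ldots,e_i\})$ over total orders $e_1\prec\cdots\prec e_n$ of $E$. Decision diagrams: for a total order $\preceq$ and $\mathcal{S}\subseteq 2^E$, the BDD $\mathsf{B}(\mathcal{S})$ (resp. ZDD $\mathsf{Z}(\mathcal{S})$) is obtained from the complete binary decision tree of $\mathcal{S}$ (internal nodes at depth $j$ labeled by the $(j+1)$-th smallest element, each with a 0-arc to $\nu_0$ and 1-arc to $\nu_1$; the leaf reached by taking 1-arcs exactly at elements of $X$ is $\top$ iff $X\in\mathcal{S}$, else $\bot$) by exhaustively: merging non-terminal nodes with the same label and same 0- and 1-successors; and for BDDs removing every non-terminal $\nu$ with $\nu_0=\nu_1$, for ZDDs every non-terminal $\nu$ with $\nu_1=\bot$, redirecting arcs entering $\nu$ to $\nu_0$. If $e_1\prec\cdots\prec e_n$, the $i$-th width ($0\le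 i\le n-1$) is the number of non-terminal nodes labeled $e_{i+1}$; the width is the maximum over $i$. *)

theory Defs
  imports Complex_Main
begin

section \<open>Matroids\<close>

locale matroid =
  fixes E :: "'a set" and \<I> :: "'a set set"
  assumes finite_ground: "finite E"
    and indep_subset_ground: "X \<in> \<I> \<Longrightarrow> X \<subseteq> E"
    and indep_empty: "{} \<in> \<I>"
    and indep_subset: "X \<in> \<I> \<Longrightarrow> Y \<subseteq> X \<Longrightarrow> Y \<in> \<I>"
    and indep_augment: "X \<in> \<I> \<Longrightarrow> Y \<in> \<I> \<Longrightarrow> card X < card Y \<Longrightarrow> \<exists>y\<in>Y - X. insert y X \<in> \<I>"

definition matroid_bases :: "'a set set \<Rightarrow> 'a set set" where
  "matroid_bases \<I> = {B \<in> \<I>. \<forall>X\<in>\<I>. B \<subseteq> X \<longrightarrow> X = B}"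

definition matroid_rank :: "'a set set \<Rightarrow> 'a set \<Rightarrow> nat" where
  "matroid_rank \<I> X = Max (card ` {Y \<in> \<I>. Y \<subseteq> X})"

definition uniform_matroid :: "'a set \<Rightarrow> 'a set set \<Rightarrow> bool" where
  "uniform_matroid E \<I> \<longleftrightarrow> matroid E \<I> \<and> \<I> = {X. X \<subseteq> E \<and> card X \<le> matroid_rank \<I> E}"

text \<open>The subtraction of naturals does not truncate, see \<open>matroid_rank_le_add_diff\<close> below.\<close>

definition connectivity :: "'a set \<Rightarrow> 'a set set \<Rightarrow> 'a set \<Rightarrow> nat" where
  "connectivity E \<I> X = matroid_rank \<I> X + matroid_rank \<I> (E - X) - matroid_rank \<I> E"

lemma (in matroid) matroid_rank_le_add_diff:
  assumes "X \<subseteq> E"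
  shows "matroid_rank \<I> E \<le> matroid_rank \<I> X + matroid_rank \<I> (E - X)"
proof -
  have fin: "finite {Y \<in> \<I>. Y \<subseteq> Z}" for Z
    by (rule finite_subset[of _ "Pow E"]) (use indep_subset_ground finite_ground in auto)
  have le: "card Y \<le> matroid_rank \<I> Z" if "Y \<in> \<I>" "Y \<subseteq> Z" for Y Z
    unfolding matroid_rank_def using that fin[of Z] by (intro Max_ge) auto
  have "matroid_rank \<I> E \<in> card ` {Y \<in> \<I>. Y \<subseteq> E}"
    unfolding matroid_rank_def using fin[of E] indep_empty by (intro Max_in) auto
  then obtain Y where Y: "Y \<in> \<I>" "Y \<subseteq> E" "matroid_rank \<I> E = card Y"
    by auto
  have "card (Y \<inter> X) \<le> matroid_rank \<I> X" "card (Y - X) \<le> matroid_rank \<I> (E - X)"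
    using Y by (auto intro!: le intro: indep_subset)
  moreover have "card Y = card (Y \<inter> X) + card (Y - X)"
    using Y(2) finite_ground finite_subset card_Int_Diff by blast
  ultimately show ?thesis
    using Y(3) by linarith
qed


section \<open>Total orders on a finite set, and path-width\<close>

definition enumerates :: "'a set \<Rightarrow> 'a rel \<Rightarrow> 'a list \<Rightarrow> bool" where
  "enumerates E r es \<longleftrightarrow> set es = E \<and> distinct es \<and> sorted_wrt (\<lambda>x y. (x, y) \<in> r) es"

definition order_enum :: "'a set \<Rightarrow> 'a rel \<Rightarrow> 'a list" where
  "order_enum E r = (THE es. enumerates E r es)"

lemma enumerates_exists:
  assumes "finite E" "linear_order_on E r"
  shows "\<exists>es. enumerates E r es"
proof -
  have "F \<subseteq> E \<Longrightarrow> \<exists>es. enumerates F r es" if "finite F" for F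
    using that
  proof (induction F rule: finite_induct)
    case empty
    show ?case by (auto simp: enumerates_def)
  next
    case (insert x F)
    then obtain es where es: "set es = F" "distinct es" "sorted_wrt (\<lambda>x y. (x, y) \<in> r) es"
      by (auto simp: enumerates_def)
    have tr: "trans r" and tot: "total_on E r"
      using assms(2) by (auto simp: order_on_defs)
    let ?A = "filter (\<lambda>y. (y, x) \<in> r) es" and ?B = "filter (\<lambda>y. (y, x) \<notin> r) es"
    have B: "(x, y) \<in> r" if "y \<in> set ?B" for y
      using that tot insert.prems insert.hyps(2) es(1) unfolding total_on_def by auto
    have "sorted_wrt (\<lambda>x y. (x, y) \<in> r) (?A @ x # ?B)"
      using es(3) B tr unfolding sorted_wrt_append
      by (auto simp: sorted_wrt_filter) (meson transD)
    moreover have "set (?A @ x # ?B) = insert x F" "distinct (?A @ x # ?B)"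
      using es(1,2) insert.hyps(2) by auto
    ultimately show ?case
      unfolding enumerates_def by blast
  qed
  then show ?thesis
    using assms(1) by blast
qed

lemma enumerates_unique:
  assumes "antisym r" "enumerates E r xs" "enumerates E r ys"
  shows "xs = ys"
  using assms(2,3)
proof (induction xs arbitrary: E ys)
  case Nil
  then show ?case by (auto simp: enumerates_def)
next
  case (Cons x xs)
  then obtain y zs where ys: "ys = y # zs"
    by (cases ys) (auto simp: enumerates_def)
  have "x = y"
  proof (rule ccontr)
    assume "x \<noteq> y"
    then have "(x, y) \<in> r" "(y, x) \<in> r"
      using Cons.prems unfolding ys enumerates_def by auto
    then show False
      using \<open>x \<noteq> y\<close> assms(1) by (auto dest: antisymD)
  qed
  moreover have "enumerates (E - {x}) r xs" "enumerates (E - {x}) r zs"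
    using Cons.prems \<open>x = y\<close> unfolding ys enumerates_def by auto
  ultimately show ?case
    using Cons.IH ys by blast
qed

lemma enumerates_order_enum:
  assumes "finite E" "linear_order_on E r"
  shows "enumerates E r (order_enum E r)"
proof -
  have "antisym r"
    using assms(2) by (auto simp: order_on_defs)
  then have "\<exists>!es. enumerates E r es"
    using enumerates_exists[OF assms] enumerates_unique by blast
  then show ?thesis
    unfolding order_enum_def by (rule theI')
qed

text \<open>
  On the naturals the supremum of the empty set is \<open>0\<close>; this fixes the value for \<open>E = {}\<close>, both
  here and for the width of a decision diagram. For \<open>E \<noteq> {}\<close> the suprema and the infimum are a
  maximum and a minimum.
\<close>

definition pathwidth :: "'a set \<Rightarrow> 'a set set \<Rightarrow> nat" where
  "pathwidth E \<I> =
    (INF r\<in>{r. linear_order_on E r}.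
      SUP i\<in>{1..card E}. connectivity E \<I> (set (take i (order_enum E r))))"


section \<open>Decision diagrams\<close>

datatype 'v vertex = Bot | Top | Inner 'v

record ('v, 'a) diagram =
  inner :: "'v set"
  label :: "'v \<Rightarrow> 'a"
  succ0 :: "'v \<Rightarrow> 'v vertex"
  succ1 :: "'v \<Rightarrow> 'v vertex"
  root_vertex :: "'v vertex"

text \<open>
  The node of the complete decision tree reached by a sequence of arcs is named by that sequence,
  with \<open>True\<close> for a 1-arc; all leaves carrying the same truth value are identified.
\<close>

definition tree_vertex :: "'a list \<Rightarrow> 'a set set \<Rightarrow> bool list \<Rightarrow> bool list vertex" where
  "tree_vertex es \<S> p =
    (if length p < length es then Inner p
     else if {es ! i |i. i < length es \<and> p ! i} \<in> \<S> then Top else Bot)"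

definition decision_tree :: "'a list \<Rightarrow> 'a set set \<Rightarrow> (bool list, 'a) diagram" where
  "decision_tree es \<S> =
    \<lparr>inner = {p. length p < length es},
     label = (\<lambda>p. es ! length p),
     succ0 = (\<lambda>p. tree_vertex es \<S> (p @ [False])),
     succ1 = (\<lambda>p. tree_vertex es \<S> (p @ [True])),
     root_vertex = tree_vertex es \<S> []\<rparr>"

text \<open>Delete the non-terminal node \<open>v\<close> and redirect all arcs entering it (and the root pointer) to \<open>w\<close>.\<close>

definition redirect :: "'v \<Rightarrow> 'v vertex \<Rightarrow> ('v, 'a) diagram \<Rightarrow> ('v, 'a) diagram" where
  "redirect v w D =
    (let f = (\<lambda>x. if x = Inner v then w else x) in
      \<lparr>inner = inner D - {v},
       label = label D,
       succ0 = f \<circ> succ0 D,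
       succ1 = f \<circ> succ1 D,
       root_vertex = f (root_vertex D)\<rparr>)"

inductive merge_step :: "('v, 'a) diagram \<Rightarrow> ('v, 'a) diagram \<Rightarrow> bool" where
  "u \<in> inner D \<Longrightarrow> v \<in> inner D \<Longrightarrow> u \<noteq> v \<Longrightarrow> label D u = label D v \<Longrightarrow>
   succ0 D u = succ0 D v \<Longrightarrow> succ1 D u = succ1 D v \<Longrightarrow> merge_step D (redirect v (Inner u) D)"

inductive bdd_step :: "('v, 'a) diagram \<Rightarrow> ('v, 'a) diagram \<Rightarrow> bool" where
  bdd_merge: "merge_step D D' \<Longrightarrow> bdd_step D D'"
| bdd_remove: "v \<in> inner D \<Longrightarrow> succ0 D v = succ1 D v \<Longrightarrow> bdd_step D (redirect v (succ0 D v) D)"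

inductive zdd_step :: "('v, 'a) diagram \<Rightarrow> ('v, 'a) diagram \<Rightarrow> bool" where
  zdd_merge: "merge_step D D' \<Longrightarrow> zdd_step D D'"
| zdd_remove: "v \<in> inner D \<Longrightarrow> succ1 D v = Bot \<Longrightarrow> zdd_step D (redirect v (succ0 D v) D)"

definition exhaustive_result :: "('d \<Rightarrow> 'd \<Rightarrow> bool) \<Rightarrow> 'd \<Rightarrow> 'd \<Rightarrow> bool" where
  "exhaustive_result step D D' \<longleftrightarrow> step\<^sup>*\<^sup>* D D' \<and> (\<nexists>D''. step D' D'')"

text \<open>
  The result of exhaustive reduction is determined only up to renaming of nodes, hence
  \<open>is_BDD\<close> and \<open>is_ZDD\<close> are predicates; such a diagram always exists, see below.
\<close>

definition is_BDD :: "'a set \<Rightarrow> 'a rel \<Rightarrow> 'a set set \<Rightarrow> (bool list, 'a) diagram \<Rightarrow> bool" where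
  "is_BDD E r \<S> = exhaustive_result bdd_step (decision_tree (order_enum E r) \<S>)"

definition is_ZDD :: "'a set \<Rightarrow> 'a rel \<Rightarrow> 'a set set \<Rightarrow> (bool list, 'a) diagram \<Rightarrow> bool" where
  "is_ZDD E r \<S> = exhaustive_result zdd_step (decision_tree (order_enum E r) \<S>)"

definition ith_width :: "'a set \<Rightarrow> 'a rel \<Rightarrow> ('v, 'a) diagram \<Rightarrow> nat \<Rightarrow> nat" where
  "ith_width E r D i = card {v \<in> inner D. label D v = order_enum E r ! i}"

definition diagram_width :: "'a set \<Rightarrow> 'a rel \<Rightarrow> ('v, 'a) diagram \<Rightarrow> nat" where
  "diagram_width E r D = (SUP i\<in>{..<card E}. ith_width E r D i)"

lemma exhaustive_result_exists:
  assumes "finite (inner D)"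
    and step: "\<And>D D'. step D D' \<Longrightarrow> \<exists>v\<in>inner D. inner D' = inner D - {v}"
  shows "\<exists>D'. exhaustive_result step D D'"
  using assms(1)
proof (induction "card (inner D)" arbitrary: D rule: less_induct)
  case less
  show ?case
  proof (cases "\<exists>D'. step D D'")
    case True
    then obtain D' where D': "step D D'"
      by blast
    then obtain v where "v \<in> inner D" "inner D' = inner D - {v}"
      using step by blast
    then have "card (inner D') < card (inner D)" "finite (inner D')"
      using less.prems by (simp_all add: card_Diff1_less del: card_Diff_insert)
    then obtain D'' where "exhaustive_result step D' D''"
      using less.hyps by blast
    then show ?thesis
      using D' unfolding exhaustive_result_def by (meson converse_rtranclp_into_rtranclp)
  next
    case False
    then show ?thesis
      unfolding exhaustive_result_def by blast
  qed
qed

lemma inner_redirect [simp]: "inner (redirect v w D) = inner D - {v}"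
  by (simp add: redirect_def Let_def)

lemma finite_inner_decision_tree: "finite (inner (decision_tree es \<S>))"
proof -
  have "inner (decision_tree es \<S>) \<subseteq> {p. set p \<subseteq> UNIV \<and> length p \<le> length es}"
    by (auto simp: decision_tree_def)
  then show ?thesis
    by (rule finite_subset) (rule finite_lists_length_le, simp)
qed

lemma is_BDD_exists: "\<exists>D. is_BDD E r \<S> D"
  unfolding is_BDD_def
  by (rule exhaustive_result_exists[OF finite_inner_decision_tree])
     (auto elim!: bdd_step.cases merge_step.cases)

lemma is_ZDD_exists: "\<exists>D. is_ZDD E r \<S> D"
  unfolding is_ZDD_def
  by (rule exhaustive_result_exists[OF finite_inner_decision_tree])
     (auto elim!: zdd_step.cases merge_step.cases)

end

theory Submission
  imports Defs
begin

text \<open>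
  Assign to every node of the decision tree the residual Boolean function (for BDDs) or the residual
  set family (for ZDDs). The reduction steps preserve this denotation, and in an exhaustively
  reduced diagram distinct nodes have distinct denotations and no node has a removable denotation.
  For a uniform matroid of rank \<open>k\<close> on \<open>n\<close> elements, the denotation at depth \<open>i\<close> depends only on
  the number \<open>c\<close> of elements already chosen. For the surviving nodes it depends only on
  \<open>max c (k - (n - i))\<close>, and this value lies between \<open>k - (n - i)\<close> and \<open>min k i\<close>.
  This leaves at most \<open>min k (n - k) + 1\<close> nodes per level. The connectivity of any
  \<open>k\<close> elements is \<open>min k (n - k)\<close>, so the path-width is at least this number.
\<close>

section \<open>Reduced diagrams and denotations\<close>

text \<open>The two reduction systems differ only in the removal test, which is abstracted here to a
  relation between the 0-successor and the 1-successor.\<close>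

inductive reduce_step ::
  "('v vertex \<Rightarrow> 'v vertex \<Rightarrow> bool) \<Rightarrow> ('v, 'a) diagram \<Rightarrow> ('v, 'a) diagram \<Rightarrow> bool"
  for removable where
  merge: "merge_step D D' \<Longrightarrow> reduce_step removable D D'"
| remove: "v \<in> inner D \<Longrightarrow> removable (succ0 D v) (succ1 D v) \<Longrightarrow>
    reduce_step removable D (redirect v (succ0 D v) D)"

lemma bdd_step_eq_reduce_step: "bdd_step = reduce_step (=)"
  by (intro ext) (auto simp: bdd_step.simps reduce_step.simps)

lemma zdd_step_eq_reduce_step: "zdd_step = reduce_step (\<lambda>x y. y = Bot)"
  by (intro ext) (auto simp: zdd_step.simps reduce_step.simps)

primrec denote :: "'f \<Rightarrow> 'f \<Rightarrow> ('v \<Rightarrow> 'f) \<Rightarrow> 'v vertex \<Rightarrow> 'f" where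
  "denote fbot ftop F Bot = fbot"
| "denote fbot ftop F Top = ftop"
| "denote fbot ftop F (Inner v) = F v"

text \<open>\<open>F p\<close> is the meaning of the tree node \<open>p\<close>, and
  \<open>redundant\<close> is the semantic counterpart of the syntactic test
  \<open>removable\<close>. A successful test is always semantically justified. The converse asks
  for injective denotations, since before full reduction distinct vertices can mean the same;
  \<open>Bot\<close> is included because the ZDD test compares with it.\<close>

locale path_semantics =
  fixes es :: "'a list" and \<S> :: "'a set set"
    and F :: "bool list \<Rightarrow> 'f" and fbot ftop :: 'f
    and removable :: "bool list vertex \<Rightarrow> bool list vertex \<Rightarrow> bool"
    and redundant :: "'f \<Rightarrow> 'f \<Rightarrow> bool"
  assumes distinct_es: "distinct es"
    and leaf: "length p = length es \<Longrightarrow>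
      F p = (if {es ! i |i. i < length es \<and> p ! i} \<in> \<S> then ftop else fbot)"
    and bot_neq_top: "fbot \<noteq> ftop"
    and node_eq_iff: "length p = length q \<Longrightarrow> length p < length es \<Longrightarrow>
      F p = F q \<longleftrightarrow> F (p @ [False]) = F (q @ [False]) \<and> F (p @ [True]) = F (q @ [True])"
    and redundant_node: "length p < length es \<Longrightarrow> redundant (F (p @ [False])) (F (p @ [True])) \<Longrightarrow>
      F p = F (p @ [False])"
    and redundant_if_deeper: "length p < length q \<Longrightarrow> length q < length es \<Longrightarrow> F p = F q \<Longrightarrow>
      redundant (F (p @ [False])) (F (p @ [True]))"
    and redundant_if_terminal: "length p < length es \<Longrightarrow> F p = fbot \<or> F p = ftop \<Longrightarrow>
      redundant (F (p @ [False])) (F (p @ [True]))"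
    and removable_imp_redundant:
      "removable x y \<Longrightarrow> redundant (denote fbot ftop F x) (denote fbot ftop F y)"
    and redundant_imp_removable:
      "inj_on (denote fbot ftop F) {Bot, x, y} \<Longrightarrow>
        redundant (denote fbot ftop F x) (denote fbot ftop F y) \<Longrightarrow> removable x y"
begin

section \<open>The invariant of reduction\<close>

abbreviation den :: "bool list vertex \<Rightarrow> 'f" where
  "den \<equiv> denote fbot ftop F"

text \<open>The admissible targets of an arc that must reach depth \<open>l\<close> or more;
  terminals count as deeper than every level.\<close>

definition below :: "(bool list, 'a) diagram \<Rightarrow> nat \<Rightarrow> bool list vertex set" where
  "below D l = {Bot, Top} \<union> Inner ` {q \<in> inner D. l \<le> length q}"

text \<open>Surviving nodes keep their tree names, so \<open>F p\<close> stays their meaning even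
  when their arcs have been redirected. Arcs never enter deleted nodes, and depth grows strictly
  along arcs, which permits induction from the leaves.\<close>

definition sound :: "(bool list, 'a) diagram \<Rightarrow> bool" where
  "sound D \<longleftrightarrow> (\<forall>p\<in>inner D. length p < length es \<and> label D p = es ! length p \<and>
     den (succ0 D p) = F (p @ [False]) \<and> den (succ1 D p) = F (p @ [True]) \<and>
     succ0 D p \<in> below D (Suc (length p)) \<and> succ1 D p \<in> below D (Suc (length p)))"

lemma soundD:
  assumes "sound D" "p \<in> inner D"
  shows "length p < length es" "label D p = es ! length p"
    "den (succ0 D p) = F (p @ [False])" "den (succ1 D p) = F (p @ [True])"
    "succ0 D p \<in> below D (Suc (length p))" "succ1 D p \<in> below D (Suc (length p))"
  using assms unfolding sound_def by blast+

lemma sound_decision_tree: "sound (decision_tree es \<S>)"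
  unfolding sound_def decision_tree_def below_def tree_vertex_def
  using leaf by (auto simp: not_less)

text \<open>Arcs into \<open>v\<close> start strictly above its level, so a replacement
  \<open>w\<close> on the same level (merging) or deeper (removal) keeps them going strictly
  down.\<close>

lemma sound_redirect:
  assumes D: "sound D" and "v \<in> inner D" and w: "den w = F v" "w \<in> below (redirect v w D) (length v)"
  shows "sound (redirect v w D)"
proof -
  have den: "den (if x = Inner v then w else x) = den x" for x
    using w by auto
  have below: "(if x = Inner v then w else x) \<in> below (redirect v w D) (Suc l)"
    if "x \<in> below D (Suc l)" for x l
    using that w(2) unfolding below_def by auto
  have succs: "succ0 (redirect v w D) p = (if succ0 D p = Inner v then w else succ0 D p)"
    "succ1 (redirect v w D) p = (if succ1 D p = Inner v then w else succ1 D p)"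
    "label (redirect v w D) = label D" for p
    by (simp_all add: redirect_def Let_def)
  show ?thesis
    unfolding sound_def
  proof (intro ballI)
    fix p assume "p \<in> inner (redirect v w D)"
    then have "p \<in> inner D"
      by simp
    note p = soundD[OF D this]
    show "length p < length es \<and> label (redirect v w D) p = es ! length p \<and>
        den (succ0 (redirect v w D) p) = F (p @ [False]) \<and>
        den (succ1 (redirect v w D) p) = F (p @ [True]) \<and>
        succ0 (redirect v w D) p \<in> below (redirect v w D) (Suc (length p)) \<and>
        succ1 (redirect v w D) p \<in> below (redirect v w D) (Suc (length p))"
      using p(1,2) below[OF p(5)] below[OF p(6)] unfolding succs den p(3,4) by simp
  qed
qed

lemma sound_reduce_step:
  assumes "reduce_step removable D D'" "sound D"
  shows "sound D'"
  using assms(1)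
proof cases
  case merge
  then show ?thesis
  proof cases
    case (1 u v)
    note u = soundD[OF assms(2) \<open>u \<in> inner D\<close>] and v = soundD[OF assms(2) \<open>v \<in> inner D\<close>]
    \<comment> \<open>As \<open>es\<close> is distinct, a label determines the depth.\<close>
    have len: "length u = length v"
      using u v 1 distinct_es by (metis nth_eq_iff_index_eq)
    then have "F u = F v"
      using node_eq_iff[of u v] u v 1 by auto
    then show ?thesis
      using 1 assms(2) len by (auto intro!: sound_redirect simp: below_def)
  qed
next
  case (remove v)
  note v = soundD[OF assms(2) \<open>v \<in> inner D\<close>]
  have "F v = F (v @ [False])"
    using removable_imp_redundant[OF remove(3)] v by (auto intro: redundant_node)
  \<comment> \<open>The 0-successor is strictly deeper than \<open>v\<close>, so it differs from
    \<open>v\<close> and survives the deletion.\<close>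
  then show ?thesis
    using remove assms(2) v(3,5) by (fastforce intro!: sound_redirect simp: below_def)
qed

lemma sound_reduce_steps: "(reduce_step removable)\<^sup>*\<^sup>* D D' \<Longrightarrow> sound D \<Longrightarrow> sound D'"
  by (induction rule: rtranclp_induct) (auto intro: sound_reduce_step)

section \<open>Exhaustively reduced diagrams\<close>

context
  fixes D
  assumes sound: "sound D" and reduced: "\<nexists>D'. reduce_step removable D D'"
begin

text \<open>Injectivity below \<open>p\<close> turns semantic redundancy into the syntactic test, so
  a removal step would still apply.\<close>

lemma not_redundant_if_inj:
  assumes "p \<in> inner D" "inj_on den (below D (Suc (length p)))"
  shows "\<not> redundant (F (p @ [False])) (F (p @ [True]))"
proof
  note p = soundD[OF sound assms(1)]
  assume "redundant (F (p @ [False])) (F (p @ [True]))"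
  then have "redundant (den (succ0 D p)) (den (succ1 D p))"
    unfolding p(3,4) .
  moreover have "inj_on den {Bot, succ0 D p, succ1 D p}"
    by (rule inj_on_subset[OF assms(2)]) (use p in \<open>auto simp: below_def\<close>)
  ultimately have "removable (succ0 D p) (succ1 D p)"
    by (intro redundant_imp_removable)
  then have "reduce_step removable D (redirect p (succ0 D p) D)"
    using assms(1) by (intro reduce_step.remove)
  then show False
    using reduced by blast
qed

text \<open>Induction from the leaves upwards. A node of level \<open>l\<close> that shares its
  denotation with a terminal or a deeper node could be removed; two nodes of level \<open>l\<close>
  with a common denotation could be merged.\<close>

lemma inj_on_den_below: "inj_on den (below D l)"
proof (induction "length es - l" arbitrary: l)
  case 0
  then have "below D l = {Bot, Top}"
    using soundD(1)[OF sound] by (fastforce simp: below_def)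
  then show ?case
    using bot_neq_top by auto
next
  case (Suc m)
  then have IH: "inj_on den (below D (Suc l))"
    by simp
  have bsplit: "below D l = below D (Suc l) \<union> Inner ` {p \<in> inner D. length p = l}"
    unfolding below_def by (auto simp: Suc_le_eq le_less)
  have new: "F p \<noteq> den x" if p: "p \<in> inner D" "length p = l" and x: "x \<in> below D (Suc l)" for p x
  proof
    assume eq: "F p = den x"
    have "redundant (F (p @ [False])) (F (p @ [True]))"
    proof (cases x)
      case (Inner q)
      then show ?thesis
        using eq x p soundD(1)[OF sound] by (intro redundant_if_deeper[of p q]) (auto simp: below_def)
    qed (use eq p soundD(1)[OF sound] in \<open>auto intro: redundant_if_terminal\<close>)
    then show False
      using not_redundant_if_inj p IH by simp
  qed
  have same: "p = q" if "p \<in> inner D" "q \<in> inner D" "length p = l" "length q = l" "F p = F q" for p q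
  proof (rule ccontr)
    assume "p \<noteq> q"
    note p = soundD[OF sound \<open>p \<in> inner D\<close>] and q = soundD[OF sound \<open>q \<in> inner D\<close>]
    have "F (p @ [False]) = F (q @ [False])" "F (p @ [True]) = F (q @ [True])"
      using node_eq_iff[of p q] that p by auto
    \<comment> \<open>The induction hypothesis turns equal meanings of successors into equal
      vertices.\<close>
    then have "succ0 D p = succ0 D q" "succ1 D p = succ1 D q"
      using p q that by (auto intro!: inj_onD[OF IH])
    then have "merge_step D (redirect q (Inner p) D)"
      using that p q \<open>p \<noteq> q\<close> by (auto intro: merge_step.intros)
    then have "reduce_step removable D (redirect q (Inner p) D)"
      by (rule reduce_step.merge)
    then show False
      using reduced by blast
  qed
  show ?case
  proof (rule inj_onI)
    fix x y assume "x \<in> below D l" "y \<in> below D l" "den x = den y"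
    then show "x = y"
      unfolding bsplit using new same IH
      by (elim UnE imageE CollectE conjE; simp; metis inj_onD)
  qed
qed

lemma inj_on_inner: "inj_on F (inner D)"
  using inj_on_den_below[of 0] by (force simp: inj_on_def below_def)

lemma not_redundant: "p \<in> inner D \<Longrightarrow> \<not> redundant (F (p @ [False])) (F (p @ [True]))"
  using not_redundant_if_inj inj_on_den_below by blast

end

text \<open>Counting by a key: \<open>g\<close> determines \<open>F\<close> on level
  \<open>i\<close>, and \<open>F\<close> is injective on the reduced diagram, so \<open>g\<close> is
  injective on the surviving nodes of that level. Only keys of non-redundant nodes have to lie in
  \<open>J\<close>.\<close>

lemma card_level_le:
  assumes "exhaustive_result (reduce_step removable) (decision_tree es \<S>) D"
    and "i < length es" "finite J"
    and in_J: "\<And>p. length p = i \<Longrightarrow> \<not> redundant (F (p @ [False])) (F (p @ [True])) \<Longrightarrow> g p \<in> J"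
    and eq: "\<And>p q. length p = i \<Longrightarrow> length q = i \<Longrightarrow> g p = g q \<Longrightarrow> F p = F q"
  shows "card {v \<in> inner D. label D v = es ! i} \<le> card J"
proof -
  have red: "\<nexists>D'. reduce_step removable D D'" and D: "sound D"
    using assms(1) sound_reduce_steps sound_decision_tree by (auto simp: exhaustive_result_def)
  have len: "length v = i" if "v \<in> inner D" "label D v = es ! i" for v
    using that soundD[OF D] assms(2) distinct_es by (metis nth_eq_iff_index_eq)
  show ?thesis
  proof (rule card_inj_on_le[of g])
    show "inj_on g {v \<in> inner D. label D v = es ! i}"
      using inj_on_inner[OF D red] eq len by (auto simp: inj_on_def)
    show "g ` {v \<in> inner D. label D v = es ! i} \<subseteq> J"
      using not_redundant[OF D red] in_J len by auto
  qed fact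
qed

end

section \<open>Residual functions and residual families\<close>

definition chosen :: "'a list \<Rightarrow> bool list \<Rightarrow> 'a set" where
  "chosen es p = {es ! i |i. i < length p \<and> p ! i}"

text \<open>The Boolean function is kept on all variables and ignores the decided ones. This makes
  nodes of different depths comparable, as a BDD arc that skips an element expresses independence of
  it.\<close>

definition residual_fun :: "'a list \<Rightarrow> 'a set set \<Rightarrow> bool list \<Rightarrow> 'a set set" where
  "residual_fun es \<S> p =
    {A. A \<subseteq> set es \<and> chosen es p \<union> (A \<inter> set (drop (length p) es)) \<in> \<S>}"

text \<open>Only undecided elements may occur, as a ZDD arc that skips an element expresses its
  absence.\<close>

definition residual_family :: "'a list \<Rightarrow> 'a set set \<Rightarrow> bool list \<Rightarrow> 'a set set" where
  "residual_family es \<S> p = {A. A \<subseteq> set (drop (length p) es) \<and> chosen es p \<union> A \<in> \<S>}"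

lemma chosen_snoc:
  "chosen es (p @ [b]) = (if b then insert (es ! length p) (chosen es p) else chosen es p)"
proof -
  have image: "chosen es q = (!) es ` {i. i < length q \<and> q ! i}" for q
    unfolding chosen_def by blast
  have "{i. i < length (p @ [b]) \<and> (p @ [b]) ! i} =
    (if b then {length p} else {}) \<union> {i. i < length p \<and> p ! i}"
    by (auto simp: nth_append split: if_splits)
  then show ?thesis
    unfolding image by simp
qed

lemma set_drop_Suc:
  "i < length es \<Longrightarrow> set (drop i es) = insert (es ! i) (set (drop (Suc i) es))"
  by (metis Cons_nth_drop_Suc list.simps(15))

lemma nth_notin_set_drop:
  "distinct es \<Longrightarrow> i < j \<Longrightarrow> j \<le> length es \<Longrightarrow> es ! i \<notin> set (drop j es)"
  by (auto simp: in_set_conv_nth nth_eq_iff_index_eq)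

section \<open>Residuals of a node and of its two children\<close>

context
  fixes es :: "'a list" and p :: "bool list"
  assumes dist: "distinct es" and len: "length p < length es"
begin

lemma mem_residual_fun_True:
  "A \<in> residual_fun es \<S> (p @ [True]) \<longleftrightarrow> A \<subseteq> set es \<and> insert (es ! length p) A \<in> residual_fun es \<S> p"
proof -
  have "chosen es (p @ [True]) \<union> (A \<inter> set (drop (Suc (length p)) es)) =
    chosen es p \<union> (insert (es ! length p) A \<inter> set (drop (length p) es))"
    using len by (auto simp: chosen_snoc set_drop_Suc)
  then show ?thesis
    using len by (simp add: residual_fun_def)
qed

lemma mem_residual_fun_False:
  "A \<in> residual_fun es \<S> (p @ [False]) \<longleftrightarrow> A \<subseteq> set es \<and> A - {es ! length p} \<in> residual_fun es \<S> p"
proof -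
  have "chosen es (p @ [False]) \<union> (A \<inter> set (drop (Suc (length p)) es)) =
    chosen es p \<union> ((A - {es ! length p}) \<inter> set (drop (length p) es))"
    using len nth_notin_set_drop[OF dist, of "length p" "Suc (length p)"]
    by (auto simp: chosen_snoc set_drop_Suc)
  then show ?thesis
    using len by (auto simp: residual_fun_def)
qed

text \<open>Shannon expansion: with the two preceding lemmas, the residual of a node and the pair of
  residuals of its children determine each other.\<close>

lemma mem_residual_fun_iff:
  "A \<in> residual_fun es \<S> p \<longleftrightarrow>
    (if es ! length p \<in> A then A \<in> residual_fun es \<S> (p @ [True]) else A \<in> residual_fun es \<S> (p @ [False]))"
proof -
  have "A \<in> residual_fun es \<S> p \<Longrightarrow> A \<subseteq> set es"
    by (simp add: residual_fun_def)
  then show ?thesis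
    by (cases "es ! length p \<in> A") (auto simp: mem_residual_fun_True mem_residual_fun_False insert_absorb)
qed

lemma mem_residual_family_True:
  "A \<in> residual_family es \<S> (p @ [True]) \<longleftrightarrow>
    es ! length p \<notin> A \<and> insert (es ! length p) A \<in> residual_family es \<S> p"
  using len nth_notin_set_drop[OF dist, of "length p" "Suc (length p)"]
  by (auto simp: residual_family_def chosen_snoc set_drop_Suc)

lemma mem_residual_family_False:
  "A \<in> residual_family es \<S> (p @ [False]) \<longleftrightarrow> es ! length p \<notin> A \<and> A \<in> residual_family es \<S> p"
  using len nth_notin_set_drop[OF dist, of "length p" "Suc (length p)"]
  by (auto simp: residual_family_def chosen_snoc set_drop_Suc)

lemma mem_residual_family_iff:
  "A \<in> residual_family es \<S> p \<longleftrightarrow>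
    (if es ! length p \<in> A then A - {es ! length p} \<in> residual_family es \<S> (p @ [True])
     else A \<in> residual_family es \<S> (p @ [False]))"
  by (cases "es ! length p \<in> A")
    (simp_all add: mem_residual_family_True mem_residual_family_False insert_absorb)

end

lemma path_semantics_BDD:
  assumes dist: "distinct es"
  shows "path_semantics es \<S> (residual_fun es \<S>) {} (Pow (set es)) (=) (=)"
proof
  fix p :: "bool list" assume "length p = length es"
  then show "residual_fun es \<S> p =
    (if {es ! i |i. i < length es \<and> p ! i} \<in> \<S> then Pow (set es) else {})"
    by (auto simp: residual_fun_def chosen_def)
next
  fix p q :: "bool list" assume len: "length p = length q" "length p < length es"
  let ?F = "residual_fun es \<S>"
  show "?F p = ?F q \<longleftrightarrow> ?F (p @ [False]) = ?F (q @ [False]) \<and> ?F (p @ [True]) = ?F (q @ [True])"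
  proof
    assume "?F p = ?F q"
    then show "?F (p @ [False]) = ?F (q @ [False]) \<and> ?F (p @ [True]) = ?F (q @ [True])"
      using len by (simp add: set_eq_iff[of "?F (_ @ _)"] mem_residual_fun_True mem_residual_fun_False dist)
  next
    assume "?F (p @ [False]) = ?F (q @ [False]) \<and> ?F (p @ [True]) = ?F (q @ [True])"
    then show "?F p = ?F q"
      using mem_residual_fun_iff[OF dist, of p] mem_residual_fun_iff[OF dist, of q] len
      by (intro set_eqI) simp
  qed
next
  fix p :: "bool list" assume "length p < length es"
    "residual_fun es \<S> (p @ [False]) = residual_fun es \<S> (p @ [True])"
  then show "residual_fun es \<S> p = residual_fun es \<S> (p @ [False])"
    using mem_residual_fun_iff[OF dist, of p] by (intro set_eqI) simp
next
  fix p q :: "bool list" assume pq: "length p < length q" "length q < length es"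
    and eq: "residual_fun es \<S> p = residual_fun es \<S> q"
  let ?e = "es ! length p"
  \<comment> \<open>At the deeper node \<open>q\<close> the element \<open>?e\<close> is already
    decided and hence ignored; by \<open>eq\<close> the function at \<open>p\<close> does not depend
    on it either.\<close>
  have "insert ?e A \<in> residual_fun es \<S> q \<longleftrightarrow> A - {?e} \<in> residual_fun es \<S> q" if "A \<subseteq> set es" for A
  proof -
    have "insert ?e A \<inter> set (drop (length q) es) = (A - {?e}) \<inter> set (drop (length q) es)"
      using nth_notin_set_drop[OF dist pq(1)] pq(2) by auto
    then show ?thesis
      using that pq unfolding residual_fun_def by auto
  qed
  then show "residual_fun es \<S> (p @ [False]) = residual_fun es \<S> (p @ [True])"
    using pq eq by (auto simp: mem_residual_fun_True mem_residual_fun_False dist)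
next
  fix p :: "bool list" assume "length p < length es"
    "residual_fun es \<S> p = {} \<or> residual_fun es \<S> p = Pow (set es)"
  then show "residual_fun es \<S> (p @ [False]) = residual_fun es \<S> (p @ [True])"
    by (auto simp: mem_residual_fun_True mem_residual_fun_False dist)
next
  fix x y :: "bool list vertex"
  assume "inj_on (denote {} (Pow (set es)) (residual_fun es \<S>)) {Bot, x, y}"
    "denote {} (Pow (set es)) (residual_fun es \<S>) x = denote {} (Pow (set es)) (residual_fun es \<S>) y"
  then show "x = y"
    by (elim inj_onD) simp_all
qed (simp_all add: dist Pow_not_empty[symmetric])

lemma path_semantics_ZDD:
  assumes dist: "distinct es"
  shows "path_semantics es \<S> (residual_family es \<S>) {} {{}} (\<lambda>x y. y = Bot) (\<lambda>X Y. Y = {})"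
proof
  fix p :: "bool list" assume "length p = length es"
  then show "residual_family es \<S> p =
    (if {es ! i |i. i < length es \<and> p ! i} \<in> \<S> then {{}} else {})"
    by (auto simp: residual_family_def chosen_def)
next
  fix p q :: "bool list" assume len: "length p = length q" "length p < length es"
  let ?F = "residual_family es \<S>"
  show "?F p = ?F q \<longleftrightarrow> ?F (p @ [False]) = ?F (q @ [False]) \<and> ?F (p @ [True]) = ?F (q @ [True])"
  proof
    assume "?F p = ?F q"
    then show "?F (p @ [False]) = ?F (q @ [False]) \<and> ?F (p @ [True]) = ?F (q @ [True])"
      using len by (simp add: set_eq_iff[of "?F (_ @ _)"] mem_residual_family_True mem_residual_family_False dist)
  next
    assume "?F (p @ [False]) = ?F (q @ [False]) \<and> ?F (p @ [True]) = ?F (q @ [True])"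
    then show "?F p = ?F q"
      using mem_residual_family_iff[OF dist, of p] mem_residual_family_iff[OF dist, of q] len
      by (intro set_eqI) simp
  qed
next
  fix p :: "bool list"
  assume len: "length p < length es" and empty: "residual_family es \<S> (p @ [True]) = {}"
  have "es ! length p \<notin> A" if "A \<in> residual_family es \<S> (p @ [False])" for A
    using that len by (simp add: mem_residual_family_False dist)
  then show "residual_family es \<S> p = residual_family es \<S> (p @ [False])"
    using empty by (intro set_eqI) (auto simp: mem_residual_family_iff[OF dist len])
next
  fix p q :: "bool list" assume pq: "length p < length q" "length q < length es"
    and eq: "residual_family es \<S> p = residual_family es \<S> q"
  \<comment> \<open>Members of the family at \<open>q\<close> use only elements from position
    \<open>length q\<close> on.\<close>
  have "es ! length p \<notin> A" if "A \<in> residual_family es \<S> q" for A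
    using that nth_notin_set_drop[OF dist pq(1)] pq(2) by (auto simp: residual_family_def)
  then show "residual_family es \<S> (p @ [True]) = {}"
    using pq eq by (fastforce simp: mem_residual_family_True dist)
next
  fix p :: "bool list"
  assume len: "length p < length es"
    and terminal: "residual_family es \<S> p = {} \<or> residual_family es \<S> p = {{}}"
  \<comment> \<open>Neither terminal family has a nonempty member.\<close>
  have "insert (es ! length p) A \<notin> residual_family es \<S> p" for A
    using terminal by (elim disjE) simp_all
  then show "residual_family es \<S> (p @ [True]) = {}"
    using mem_residual_family_True[OF dist len] by blast
next
  fix x y :: "bool list vertex"
  assume "inj_on (denote {} {{}} (residual_family es \<S>)) {Bot, x, y}"
    "denote {} {{}} (residual_family es \<S>) y = {}"
  then show "y = Bot"
    by (elim inj_onD) simp_all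
qed (simp_all add: dist Pow_not_empty[symmetric])

section \<open>Families determined by cardinality\<close>

lemma card_chosen:
  assumes "distinct es" "length p \<le> length es"
  shows "card (chosen es p) = count_list p True"
  using assms(2)
proof (induction p rule: rev_induct)
  case (snoc b p)
  have "es ! length p \<notin> chosen es p"
    using assms(1) snoc.prems by (auto simp: chosen_def nth_eq_iff_index_eq)
  moreover have "finite (chosen es p)"
    by (simp add: chosen_def)
  ultimately show ?case
    using snoc by (auto simp: chosen_snoc)
qed (simp add: chosen_def)

lemma card_chosen_Un:
  assumes "distinct es" "length p \<le> length es" "A \<subseteq> set (drop (length p) es)"
  shows "card (chosen es p \<union> A) = count_list p True + card A"
proof -
  have "chosen es p \<inter> set (drop (length p) es) = {}"
    using nth_notin_set_drop[OF assms(1) _ assms(2)] by (auto simp: chosen_def)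
  then have "chosen es p \<inter> A = {}"
    using assms(3) by blast
  moreover have "finite A" "finite (chosen es p)"
    using assms(3) finite_subset by (auto simp: chosen_def)
  ultimately show ?thesis
    using assms(1,2) by (simp add: card_Un_disjoint card_chosen)
qed

lemma card_le_if_subset_drop: "A \<subseteq> set (drop i es) \<Longrightarrow> card A \<le> length es - i"
  by (metis List.finite_set card_length card_mono le_trans length_drop)

lemma chosen_subset: "length p \<le> length es \<Longrightarrow> chosen es p \<subseteq> set es"
  by (auto simp: chosen_def)

text \<open>The predicate \<open>P\<close> lets independent sets (\<open>c \<le> k\<close>) and
  bases (\<open>c = k\<close>) be treated together; the path enters only through its length and its
  number of 1-arcs.\<close>

lemma mem_residual_fun_card:
  assumes "distinct es" "length p \<le> length es"
  shows "A \<in> residual_fun es {X. X \<subseteq> set es \<and> P (card X)} p \<longleftrightarrow>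
    A \<subseteq> set es \<and> P (count_list p True + card (A \<inter> set (drop (length p) es)))"
  using assms chosen_subset[OF assms(2)] by (auto simp: residual_fun_def card_chosen_Un)

lemma mem_residual_family_card:
  assumes "distinct es" "length p \<le> length es"
  shows "A \<in> residual_family es {X. X \<subseteq> set es \<and> P (card X)} p \<longleftrightarrow>
    A \<subseteq> set (drop (length p) es) \<and> P (count_list p True + card A)"
  using assms chosen_subset[OF assms(2)] set_drop_subset[of "length p" es]
  by (auto simp: residual_family_def card_chosen_Un)

text \<open>If \<open>k \<le> n - i\<close>, the lower end truncates to \<open>0\<close> and
  \<open>i \<le> n - k\<close>. Otherwise the ends differ by at most
  \<open>min (n - i) (n - k)\<close>, and \<open>n - i < k\<close>.\<close>

lemma card_level_interval: "k \<le> n \<Longrightarrow> i < n \<Longrightarrow> card {k - (n - i)..min k i} \<le> min k (n - k) + 1"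
  for k n i :: nat
  by auto

lemma BDD_level_le:
  assumes P: "P = (\<lambda>c. c \<le> k) \<or> P = (\<lambda>c. c = k)"
    and dist: "distinct es" and k: "k \<le> length es" and i: "i < length es"
    and D: "exhaustive_result bdd_step (decision_tree es {X. X \<subseteq> set es \<and> P (card X)}) D"
  shows "card {v \<in> inner D. label D v = es ! i} \<le> min k (length es - k) + 1"
proof -
  let ?S = "{X. X \<subseteq> set es \<and> P (card X)}"
  let ?J = "{k - (length es - i)..min k i}"
  interpret path_semantics es ?S "residual_fun es ?S" "{}" "Pow (set es)" "(=)" "(=)"
    by (rule path_semantics_BDD[OF dist])
  have "card {v \<in> inner D. label D v = es ! i} \<le> card ?J"
  proof (rule card_level_le[where g = "\<lambda>p. count_list p True"])
    show "exhaustive_result (reduce_step (=)) (decision_tree es ?S) D"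
      using D by (simp add: bdd_step_eq_reduce_step)
  next
    fix p :: "bool list" assume p: "length p = i"
      and "residual_fun es ?S (p @ [False]) \<noteq> residual_fun es ?S (p @ [True])"
    then obtain A where "P (count_list p True + card (A \<inter> set (drop (Suc i) es))) \<noteq>
        P (Suc (count_list p True + card (A \<inter> set (drop (Suc i) es))))"
      using i dist by (auto simp: set_eq_iff mem_residual_fun_card)
    \<comment> \<open>\<open>P\<close> changes between consecutive values only if one of them is
      \<open>k\<close>. With at most \<open>n - i - 1\<close> elements left after the current one,
      where \<open>n\<close> is the length of \<open>es\<close>, the count \<open>c\<close>
      satisfies \<open>c \<le> k \<le> c + (n - i)\<close>.\<close>
    moreover have "card (A \<inter> set (drop (Suc i) es)) \<le> length es - Suc i"
      by (rule card_le_if_subset_drop) simp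
    ultimately show "count_list p True \<in> ?J"
      using P p i count_le_length[of p True] by auto
  next
    fix p q :: "bool list" assume "length p = i" "length q = i" "count_list p True = count_list q True"
    then show "residual_fun es ?S p = residual_fun es ?S q"
      using i dist by (auto simp: mem_residual_fun_card)
  qed (use i in auto)
  then show ?thesis
    using card_level_interval[OF k i] by linarith
qed

lemma ZDD_level_le:
  assumes P: "P = (\<lambda>c. c \<le> k) \<or> P = (\<lambda>c. c = k)"
    and dist: "distinct es" and k: "k \<le> length es" and i: "i < length es"
    and D: "exhaustive_result zdd_step (decision_tree es {X. X \<subseteq> set es \<and> P (card X)}) D"
  shows "card {v \<in> inner D. label D v = es ! i} \<le> min k (length es - k) + 1"
proof -
  let ?S = "{X. X \<subseteq> set es \<and> P (card X)}"
  let ?J = "{k - (length es - i)..min k i}"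
  interpret path_semantics es ?S "residual_family es ?S" "{}" "{{}}" "\<lambda>x y. y = Bot" "\<lambda>X Y. Y = {}"
    by (rule path_semantics_ZDD[OF dist])
  \<comment> \<open>For independent sets, every count up to \<open>k - (n - i)\<close>, with
    \<open>n\<close> the length of \<open>es\<close>, leaves all subsets of the remaining elements
    admissible. Such nodes are not removable in a ZDD but share one residual family, so
    \<open>max\<close> gives them one key.\<close>
  let ?g = "\<lambda>p. if P = (\<lambda>c. c \<le> k) then max (count_list p True) (k - (length es - i)) else count_list p True"
  have "card {v \<in> inner D. label D v = es ! i} \<le> card ?J"
  proof (rule card_level_le[where g = ?g])
    show "exhaustive_result (reduce_step (\<lambda>x y. y = Bot)) (decision_tree es ?S) D"
      using D by (simp add: zdd_step_eq_reduce_step)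
  next
    fix p :: "bool list" assume p: "length p = i" and "residual_family es ?S (p @ [True]) \<noteq> {}"
    then obtain A where "A \<subseteq> set (drop (Suc i) es)" "P (Suc (count_list p True + card A))"
      using i dist by (auto simp: mem_residual_family_card)
    moreover from this have "card A \<le> length es - Suc i"
      by (intro card_le_if_subset_drop)
    \<comment> \<open>A nonempty 1-child bounds the count below \<open>k\<close>. The lower end of
      \<open>?J\<close> is at most \<open>i\<close> because \<open>k\<close> is at most the length
      of \<open>es\<close>, so taking \<open>max\<close> stays inside the interval.\<close>
    ultimately show "?g p \<in> ?J"
      using P p i k count_le_length[of p True] by auto
  next
    fix p q :: "bool list" assume pq: "length p = i" "length q = i" "?g p = ?g q"
    \<comment> \<open>Equal keys mean equal counts or, for independent sets, two counts so small
      that both sides hold for every such \<open>A\<close>.\<close>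
    have iff: "P (count_list p True + card A) \<longleftrightarrow> P (count_list q True + card A)"
      if "A \<subseteq> set (drop i es)" for A
      using pq(3) P card_le_if_subset_drop[OF that] by (auto split: if_splits)
    show "residual_family es ?S p = residual_family es ?S q"
    proof (rule set_eqI)
      fix A
      have "length p \<le> length es" "length q \<le> length es"
        using pq(1,2) i by simp_all
      then show "A \<in> residual_family es ?S p \<longleftrightarrow> A \<in> residual_family es ?S q"
        unfolding mem_residual_family_card[OF dist \<open>length p \<le> length es\<close>]
          mem_residual_family_card[OF dist \<open>length q \<le> length es\<close>] pq(1,2)
        using iff by (intro conj_cong refl)
    qed
  qed (use i in auto)
  then show ?thesis
    using card_level_interval[OF k i] by linarith
qed

section \<open>Uniform matroids\<close>

context
  fixes E :: "'a set" and \<I> :: "'a set set"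
  assumes fin: "finite E" and unif: "uniform_matroid E \<I>"
begin

lemma uniform_indep: "\<I> = {X. X \<subseteq> E \<and> card X \<le> matroid_rank \<I> E}"
  using unif by (simp add: uniform_matroid_def)

text \<open>Any subset of \<open>X\<close> of the size on the right is independent, so the maximum
  is attained.\<close>

lemma uniform_rank:
  assumes "X \<subseteq> E"
  shows "matroid_rank \<I> X = min (card X) (matroid_rank \<I> E)"
  unfolding matroid_rank_def[of \<I> X]
proof (rule Max_eqI)
  have X: "finite X"
    using assms fin finite_subset by blast
  then show "finite (card ` {Y \<in> \<I>. Y \<subseteq> X})"
    by simp
  show "y \<le> min (card X) (matroid_rank \<I> E)" if "y \<in> card ` {Y \<in> \<I>. Y \<subseteq> X}" for y
    using that X uniform_indep by (auto intro: card_mono)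
  obtain Y where "Y \<subseteq> X" "card Y = min (card X) (matroid_rank \<I> E)"
    using obtain_subset_with_card_n[of "min (card X) (matroid_rank \<I> E)" X] by auto
  moreover from this have "Y \<in> \<I>"
    using assms by (subst uniform_indep) auto
  ultimately show "min (card X) (matroid_rank \<I> E) \<in> card ` {Y \<in> \<I>. Y \<subseteq> X}"
    by (metis (mono_tags, lifting) image_eqI mem_Collect_eq)
qed

lemma uniform_rank_le: "matroid_rank \<I> E \<le> card E"
  using uniform_rank[of E] by simp

text \<open>An independent set below full rank misses some element of \<open>E\<close>, and adding
  it keeps the set independent.\<close>

lemma uniform_bases: "matroid_bases \<I> = {X. X \<subseteq> E \<and> card X = matroid_rank \<I> E}"
proof (intro set_eqI iffI)
  fix B assume "B \<in> matroid_bases \<I>"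
  then have B: "B \<subseteq> E" "card B \<le> matroid_rank \<I> E"
    and max: "\<And>X. X \<in> \<I> \<Longrightarrow> B \<subseteq> X \<Longrightarrow> X = B"
    using uniform_indep by (auto simp: matroid_bases_def)
  have "card B = matroid_rank \<I> E"
  proof (rule ccontr)
    assume "card B \<noteq> matroid_rank \<I> E"
    then have less: "card B < matroid_rank \<I> E"
      using B by simp
    then have "B \<noteq> E"
      using uniform_rank_le by auto
    then obtain x where x: "x \<in> E" "x \<notin> B"
      using B by blast
    have "insert x B \<in> \<I>"
      using x B less finite_subset[OF _ fin] by (subst uniform_indep) auto
    then show False
      using max[of "insert x B"] x by auto
  qed
  then show "B \<in> {X. X \<subseteq> E \<and> card X = matroid_rank \<I> E}"
    using B by simp
next
  fix B assume B: "B \<in> {X. X \<subseteq> E \<and> card X = matroid_rank \<I> E}"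
  have "X = B" if "X \<in> \<I>" "B \<subseteq> X" for X
  proof -
    have "X \<subseteq> E" "card X \<le> card B"
      using that B uniform_indep by auto
    then show ?thesis
      using that(2) finite_subset[OF _ fin] by (metis card_seteq)
  qed
  moreover have "B \<in> \<I>"
    using B by (subst uniform_indep) auto
  ultimately show "B \<in> matroid_bases \<I>"
    by (auto simp: matroid_bases_def)
qed

lemma uniform_pathwidth_ge:
  assumes "linear_order_on E r"
  shows "min (matroid_rank \<I> E) (card E - matroid_rank \<I> E) \<le> pathwidth E \<I>"
  unfolding pathwidth_def
proof (rule cINF_greatest)
  show "{r. linear_order_on E r} \<noteq> {}"
    using assms by blast
  fix r' assume "r' \<in> {r. linear_order_on E r}"
  then have en: "set (order_enum E r') = E" "distinct (order_enum E r')"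
    using enumerates_order_enum[OF fin] by (auto simp: enumerates_def)
  let ?k = "matroid_rank \<I> E"
  \<comment> \<open>Whatever the order, the prefix of size \<open>?k\<close> has full rank, so its
    connectivity is the rank of its complement.\<close>
  let ?X = "set (take ?k (order_enum E r'))"
  let ?f = "\<lambda>i. connectivity E \<I> (set (take i (order_enum E r')))"
  have X: "?X \<subseteq> E" "card ?X = ?k"
    using en uniform_rank_le distinct_card[of "order_enum E r'"]
    by (auto dest: in_set_takeD simp: distinct_card)
  then have "card (E - ?X) = card E - ?k"
    by (simp add: card_Diff_subset)
  then have f: "?f ?k = min ?k (card E - ?k)"
    using X uniform_rank[of ?X] uniform_rank[of "E - ?X"] by (simp add: connectivity_def)
  show "min ?k (card E - ?k) \<le> (SUP i\<in>{1..card E}. ?f i)"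
  \<comment> \<open>The index \<open>0\<close> lies outside the range of the supremum, but then the
    bound to be shown is \<open>0\<close>.\<close>
  proof (cases "?k = 0")
    case False
    then have "?f ?k \<le> (SUP i\<in>{1..card E}. ?f i)"
      using uniform_rank_le by (intro cSUP_upper bdd_above_finite) auto
    then show ?thesis
      using f by simp
  qed simp
qed

end

lemma diagram_width_le:
  assumes "\<And>i. i < card E \<Longrightarrow> ith_width E r D i \<le> b"
  shows "diagram_width E r D \<le> b"
\<comment> \<open>The least-upper-bound rule asks for a nonempty index set; the empty supremum is
  \<open>0\<close>.\<close>
proof (cases "card E = 0")
  case False
  then show ?thesis
    unfolding diagram_width_def using assms by (intro cSUP_least) auto
qed (simp add: diagram_width_def)

theorem theorem4p11:
  fixes E :: "'a set" and \<I> :: "'a set set" and r :: "'a rel"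
  assumes "finite E" and "uniform_matroid E \<I>" and "linear_order_on E r"
  shows "(\<forall>D. is_BDD E r \<I> D \<longrightarrow> diagram_width E r D \<le> pathwidth E \<I> + 1) \<and>
         (\<forall>D. is_BDD E r (matroid_bases \<I>) D \<longrightarrow> diagram_width E r D \<le> pathwidth E \<I> + 1) \<and>
         (\<forall>D. is_ZDD E r \<I> D \<longrightarrow> diagram_width E r D \<le> pathwidth E \<I> + 1) \<and>
         (\<forall>D. is_ZDD E r (matroid_bases \<I>) D \<longrightarrow> diagram_width E r D \<le> pathwidth E \<I> + 1)"
proof -
  let ?k = "matroid_rank \<I> E" and ?es = "order_enum E r"
  have es: "set ?es = E" "distinct ?es"
    using enumerates_order_enum[OF assms(1,3)] by (auto simp: enumerates_def)
  then have len: "length ?es = card E"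
    using distinct_card by fastforce
  note k = uniform_rank_le[OF assms(1,2)]
  note pw = uniform_pathwidth_ge[OF assms]
  \<comment> \<open>\<open>P\<close> and \<open>\<S>\<close> stay general so that the cardinality
    descriptions of independent sets and of bases can both be inserted.\<close>
  have main: "diagram_width E r D \<le> pathwidth E \<I> + 1"
    if P: "P = (\<lambda>c. c \<le> ?k) \<or> P = (\<lambda>c. c = ?k)" and S: "\<S> = {X. X \<subseteq> E \<and> P (card X)}"
      and D: "is_BDD E r \<S> D \<or> is_ZDD E r \<S> D" for P \<S> D
  proof (rule diagram_width_le)
    fix i assume i: "i < card E"
    have "ith_width E r D i \<le> min ?k (card E - ?k) + 1"
      using D
    proof
      assume "is_BDD E r \<S> D"
      then show ?thesis
        using BDD_level_le[OF P es(2), of i D] k i len es(1)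
        by (simp add: is_BDD_def S ith_width_def)
    next
      assume "is_ZDD E r \<S> D"
      then show ?thesis
        using ZDD_level_le[OF P es(2), of i D] k i len es(1)
        by (simp add: is_ZDD_def S ith_width_def)
    qed
    then show "ith_width E r D i \<le> pathwidth E \<I> + 1"
      using pw by linarith
  qed
  note indep = main[OF disjI1[OF refl] uniform_indep[OF assms(1,2)]]
  note bases = main[OF disjI2[OF refl] uniform_bases[OF assms(1,2)]]
  show ?thesis
    by (intro conjI allI impI) (erule indep[OF disjI1] bases[OF disjI1] indep[OF disjI2] bases[OF disjI2])+
qed

end
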